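(* Let $V=(V_1,\dots,V_k)$ be a closed $k$-gon in $\mathbb{R}^n$. Then the discrete bicycle monodromy $M_{V,\ell}:S^{n-1}\to S^{n-1}$ is a Möbius transformation of the sphere of radius $\ell$.
   Context: A closed $k$-gon in $\mathbb{R}^n$ is a sequence of points $V_i\in\mathbb{R}^n$ with $V_{i+k}=V_i$ for all $i$. Discrete bicycle construction with length parameter $\ell$: let $V_1W_1$ be a seed segment of length $\ell$. The point $W_2$ is constructed in the plane spanned by $V_1,V_2,W_1$: parallel translate $W_1$ along the vector $V_1V_2$ to the point $U$, and then reflect $U$ in the line $W_1V_2$ to obtain $W_2$. In other words, $V_1,V_2,W_1,W_2$ are the vertices of a plane isosceles trapezoid with $|V_1V_2|=|W_1W_2|$ and $|V_1W_1|=|V_2W_2|=\ell$. Once $W_2$ is constructed, one continues the process, shifting the index by one, and so on, obtaining points $W_3,W_4,\dots$ with $|V_iW_i|=\ell$. For a closed $k$-gon $V$ the polygon $W$ need not close up. The discrete bicycle monodromy $M_{V,\ell}$ is the map that sends the initial position $V_1W_1$ of the segment to its terminal position $V_{k+1}W_{k+1}=V_1W_{k+1}$ after going once around $V$; it is a self-map of the sphere $S^{n-1}$ of radius $\ell$ centered at $V_1$. The Möbius group of $S^{n-1}$ is the group $O(n,1)$ of linear isometries of the pseudo-Euclidean space $\mathbb{R}^{n,1}$, acting projectively on $S^{n-1}$, the spherization of the null cone. *)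

theory Defs
  imports "HOL-Analysis.Analysis"
begin

definition closed_polygon :: "nat \<Rightarrow> (nat \<Rightarrow> real ^ 'n) \<Rightarrow> bool" where
  "closed_polygon k V \<longleftrightarrow> 0 < k \<and> (\<forall>i. V (i + k) = V i)"

text \<open>The orthogonal projection onto the line \<open>A B\<close> is the midpoint of a point and its mirror
  image.  For \<open>A = B\<close> there is no line and the value is meaningless.\<close>

definition reflect_in_line :: "real ^ 'n \<Rightarrow> real ^ 'n \<Rightarrow> real ^ 'n \<Rightarrow> real ^ 'n" where
  "reflect_in_line A B X = 2 *\<^sub>R closest_point (affine hull {A, B}) X - X"

definition bicycle_step :: "real ^ 'n \<Rightarrow> real ^ 'n \<Rightarrow> real ^ 'n \<Rightarrow> real ^ 'n" where
  "bicycle_step V\<^sub>1 V\<^sub>2 W\<^sub>1 = (let U = W\<^sub>1 + (V\<^sub>2 - V\<^sub>1) in reflect_in_line W\<^sub>1 V\<^sub>2 U)"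

text \<open>Polygons are indexed from 1, so with the seed \<open>V\<^sub>1 W\<^sub>1\<close> the point \<open>W\<close> with index \<open>i + 1\<close>
  is \<open>bicycle_track V W\<^sub>1 i\<close>.\<close>

primrec bicycle_track :: "(nat \<Rightarrow> real ^ 'n) \<Rightarrow> real ^ 'n \<Rightarrow> nat \<Rightarrow> real ^ 'n" where
  "bicycle_track V W\<^sub>1 0 = W\<^sub>1"
| "bicycle_track V W\<^sub>1 (Suc i) = bicycle_step (V (i + 1)) (V (i + 2)) (bicycle_track V W\<^sub>1 i)"

text \<open>The construction can be carried out once around \<open>V\<close> from every seed of length \<open>l\<close>: the
  two points determining the mirror line are distinct at each of the \<open>k\<close> steps.  Without this the
  monodromy is not a map on the whole sphere.\<close>

definition bicycle_constructible :: "nat \<Rightarrow> (nat \<Rightarrow> real ^ 'n) \<Rightarrow> real \<Rightarrow> bool" where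
  "bicycle_constructible k V l \<longleftrightarrow>
     (\<forall>W\<^sub>1 \<in> sphere (V 1) l. \<forall>i<k. bicycle_track V W\<^sub>1 i \<noteq> V (i + 2))"

definition bicycle_monodromy ::
    "nat \<Rightarrow> (nat \<Rightarrow> real ^ 'n) \<Rightarrow> real \<Rightarrow> real ^ 'n \<Rightarrow> real ^ 'n" where
  "bicycle_monodromy k V l = (\<lambda>W\<^sub>1 \<in> sphere (V 1) l. bicycle_track V W\<^sub>1 k)"

text \<open>The pseudo-Euclidean space of signature \<open>(n, 1)\<close> is modelled on \<open>real ^ 'n \<times> real\<close>.\<close>

definition lorentz_form :: "(real ^ 'n) \<times> real \<Rightarrow> (real ^ 'n) \<times> real \<Rightarrow> real" where
  "lorentz_form p q = fst p \<bullet> fst q - snd p * snd q"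

definition lorentz_group :: "((real ^ 'n) \<times> real \<Rightarrow> (real ^ 'n) \<times> real) set" where
  "lorentz_group = {A. linear A \<and> (\<forall>p q. lorentz_form (A p) (A q) = lorentz_form p q)}"

text \<open>For \<open>r > 0\<close>, \<open>x \<mapsto> null_line c r x\<close> identifies the sphere of radius \<open>r\<close> about \<open>c\<close> with
  the projectivized null cone; the projective action of \<open>lorentz_group\<close> is its action on these
  lines.\<close>

definition null_line :: "real ^ 'n \<Rightarrow> real \<Rightarrow> real ^ 'n \<Rightarrow> ((real ^ 'n) \<times> real) set" where
  "null_line c r x = span {(x - c, r)}"

definition moebius_on_sphere :: "real ^ 'n \<Rightarrow> real \<Rightarrow> (real ^ 'n \<Rightarrow> real ^ 'n) \<Rightarrow> bool" where
  "moebius_on_sphere c r f \<longleftrightarrow>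
     f \<in> sphere c r \<rightarrow> sphere c r \<and>
     (\<exists>A \<in> lorentz_group. \<forall>x \<in> sphere c r. null_line c r (f x) = A ` null_line c r x)"

end

theory Submission
  imports Defs
begin

text \<open>Write the segment at a vertex as \<open>x = W\<^sub>1 - V\<^sub>1\<close> and the edge as \<open>v = V\<^sub>2 - V\<^sub>1\<close>.  The
  trapezoid construction sends \<open>x\<close> to its mirror image in the line spanned by \<open>v - x\<close>.  Multiplied
  by \<open>\<bar>v - x\<bar>\<^sup>2\<close>, which on the sphere \<open>\<bar>x\<bar> = l\<close> equals \<open>\<bar>v\<bar>\<^sup>2 + l\<^sup>2 - 2 x \<cdot> v\<close>, the quadratic terms
  in \<open>x\<close> cancel, and the new segment becomes an affine function of \<open>x\<close>.  Hence one step is the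
  projective action, on null vectors \<open>(x, l)\<close>, of a linear map of \<open>\<real>\<^sup>n \<times> \<real>\<close>; this map multiplies
  the Lorentz form by \<open>(l\<^sup>2 - \<bar>v\<bar>\<^sup>2)\<^sup>2\<close>, so after division by \<open>l\<^sup>2 - \<bar>v\<bar>\<^sup>2\<close> it is a Lorentz isometry
  (lemma \<open>moebius_between_bicycle_step\<close>).  The monodromy is a composition of such steps.

  The division needs every edge to have length different from \<open>l\<close>.  This is forced by
  constructibility: as long as the steps so far were Moebius maps, their composition is onto the
  sphere about the current vertex (lemma \<open>moebius_between_onto\<close>), so an edge of length \<open>l\<close> would
  have its far endpoint hit by the moving segment for some seed, and no mirror line would
  exist there.\<close>

section \<open>Moebius maps between spheres of equal radius\<close>

text \<open>The segment moves from vertex to vertex, so the intermediate maps go between spheres with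
  different centres; identifying both spheres with the same null cone extends the notion of a
  Moebius transformation to them.\<close>

definition moebius_between :: "real ^ 'n \<Rightarrow> real ^ 'n \<Rightarrow> real \<Rightarrow> (real ^ 'n \<Rightarrow> real ^ 'n) \<Rightarrow> bool" where
  "moebius_between c c' r f \<longleftrightarrow>
     f \<in> sphere c r \<rightarrow> sphere c' r \<and>
     (\<exists>A \<in> lorentz_group. \<forall>x \<in> sphere c r. null_line c' r (f x) = A ` null_line c r x)"

lemma moebius_between_same_centre: "moebius_between c c r f \<longleftrightarrow> moebius_on_sphere c r f"
  by (simp add: moebius_between_def moebius_on_sphere_def)

lemma moebius_between_cong:
  assumes "\<And>x. x \<in> sphere c r \<Longrightarrow> f x = g x"
  shows "moebius_between c c' r f \<longleftrightarrow> moebius_between c c' r g"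
proof -
  have "f \<in> sphere c r \<rightarrow> sphere c' r \<longleftrightarrow> g \<in> sphere c r \<rightarrow> sphere c' r"
    using assms by (intro Pi_cong) auto
  moreover have "(\<forall>x \<in> sphere c r. null_line c' r (f x) = A ` null_line c r x)
      \<longleftrightarrow> (\<forall>x \<in> sphere c r. null_line c' r (g x) = A ` null_line c r x)" for A
    by (intro ball_cong refl) (simp only: assms)
  ultimately show ?thesis unfolding moebius_between_def by simp
qed

lemma lorentz_group_id: "id \<in> lorentz_group"
  by (simp add: lorentz_group_def linear_id)

lemma lorentz_group_comp:
  assumes "A \<in> lorentz_group" "B \<in> lorentz_group"
  shows "B \<circ> A \<in> lorentz_group"
  using assms unfolding lorentz_group_def by (simp add: linear_compose del: split_paired_All)

lemma moebius_between_id: "moebius_between c c r (\<lambda>x. x)"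
  unfolding moebius_between_def using lorentz_group_id by (intro conjI bexI[of _ id]) auto

lemma moebius_between_comp:
  assumes "moebius_between c c' r f" "moebius_between c' c'' r g"
  shows "moebius_between c c'' r (\<lambda>x. g (f x))"
proof -
  obtain A where A: "A \<in> lorentz_group"
      "\<And>x. x \<in> sphere c r \<Longrightarrow> null_line c' r (f x) = A ` null_line c r x"
    using assms(1) unfolding moebius_between_def by blast
  obtain B where B: "B \<in> lorentz_group"
      "\<And>x. x \<in> sphere c' r \<Longrightarrow> null_line c'' r (g x) = B ` null_line c' r x"
    using assms(2) unfolding moebius_between_def by blast
  have f: "f \<in> sphere c r \<rightarrow> sphere c' r" and g: "g \<in> sphere c' r \<rightarrow> sphere c'' r"
    using assms by (simp_all only: moebius_between_def)
  have "null_line c'' r (g (f x)) = (B \<circ> A) ` null_line c r x" if "x \<in> sphere c r" for x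
    using A(2)[OF that] B(2)[OF funcset_mem[OF f that]] by (simp only: image_comp)
  then show ?thesis
    unfolding moebius_between_def using lorentz_group_comp[OF A(1) B(1)]
    by (intro conjI bexI[of _ "B \<circ> A"] ballI Pi_I funcset_mem[OF g] funcset_mem[OF f])
qed

section \<open>Lorentz isometries permute the null lines\<close>

text \<open>A vector in the kernel would be Lorentz-orthogonal to everything, and the form is
  nondegenerate; finite dimension turns injectivity into surjectivity.\<close>

lemma lorentz_group_surj:
  fixes A :: "(real ^ 'n) \<times> real \<Rightarrow> (real ^ 'n) \<times> real"
  assumes "A \<in> lorentz_group"
  shows "surj A"
proof -
  have lin: "linear A" and iso: "\<And>p q. lorentz_form (A p) (A q) = lorentz_form p q"
    using assms by (auto simp: lorentz_group_def)
  have "p = 0" if "A p = 0" for p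
  proof -
    have "lorentz_form p (fst p, - snd p) = 0"
      using iso[of p "(fst p, - snd p)"] that by (simp add: lorentz_form_def)
    then have "fst p \<bullet> fst p + snd p * snd p = 0"
      by (simp add: lorentz_form_def)
    then have "fst p = 0 \<and> snd p = 0"
      by (metis add_nonneg_eq_0_iff inner_eq_zero_iff inner_ge_zero mult_eq_0_iff zero_le_square)
    then show "p = 0" by (simp add: prod_eq_iff)
  qed
  then have "inj A" using lin by (simp add: linear_injective_0)
  then show ?thesis using lin linear_injective_imp_surjective by blast
qed

lemma span_singleton_scaleR:
  fixes p :: "'a :: real_vector"
  assumes "a \<noteq> 0"
  shows "span {a *\<^sub>R p} = span {p}"
proof
  show "span {a *\<^sub>R p} \<subseteq> span {p}"
    by (rule span_minimal) (auto intro: span_scale span_base)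
  have "inverse a *\<^sub>R (a *\<^sub>R p) \<in> span {a *\<^sub>R p}"
    by (intro span_scale span_base) simp
  then have "p \<in> span {a *\<^sub>R p}" using assms by simp
  then show "span {p} \<subseteq> span {a *\<^sub>R p}"
    by (intro span_minimal) auto
qed

lemma null_line_eqI:
  assumes "a \<noteq> 0" "p = a *\<^sub>R (x - c, r)"
  shows "span {p} = null_line c r x"
  using assms span_singleton_scaleR unfolding null_line_def by blast

lemma image_null_line:
  assumes "linear A"
  shows "A ` null_line c r x = span {A (x - c, r)}"
  using linear_span_image[OF assms, of "{(x - c, r)}"] by (simp add: null_line_def)

lemma null_line_inject:
  assumes "r \<noteq> 0" "null_line c r x = null_line c r y"
  shows "x = y"
proof -
  have "(x - c, r) \<in> span {(y - c, r)}"
    using assms(2) span_base[of "(x - c, r)" "{(x - c, r)}"] by (simp add: null_line_def)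
  then obtain a where "(x - c, r) = a *\<^sub>R (y - c, r)"
    unfolding span_singleton by blast
  then have "x - c = a *\<^sub>R (y - c)" "r = a * r" by simp_all
  then show ?thesis using assms(1) by simp
qed

text \<open>The Lorentz preimage of a null vector is null, and after rescaling it comes from a point of
  the source sphere.\<close>

lemma moebius_between_onto:
  assumes mo: "moebius_between c c' r f" and r: "0 < r" and y: "y \<in> sphere c' r"
  obtains x where "x \<in> sphere c r" "f x = y"
proof -
  obtain A where A: "A \<in> lorentz_group"
      "\<And>x. x \<in> sphere c r \<Longrightarrow> null_line c' r (f x) = A ` null_line c r x"
    using mo unfolding moebius_between_def by blast
  have lin: "linear A" using A(1) by (simp add: lorentz_group_def)
  obtain p where p: "A p = (y - c', r)"
    using lorentz_group_surj[OF A(1)] by (metis surjD)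
  have "lorentz_form p p = lorentz_form (A p) (A p)"
    using A(1) by (simp add: lorentz_group_def del: split_paired_All)
  also have "\<dots> = (norm (y - c'))\<^sup>2 - r\<^sup>2"
    by (simp add: p lorentz_form_def power2_norm_eq_inner) (simp add: power2_eq_square)
  also have "\<dots> = 0" using y by (simp add: dist_norm norm_minus_commute)
  finally have null: "(norm (fst p))\<^sup>2 = (snd p)\<^sup>2"
    by (simp add: lorentz_form_def power2_norm_eq_inner) (simp add: power2_eq_square)
  have nz: "snd p \<noteq> 0"
  proof
    assume "snd p = 0"
    then have "p = 0" using null by (simp add: prod_eq_iff)
    then have "A p = 0" using lin by (simp add: linear_0)
    then show False using p r by (simp add: prod_eq_iff)
  qed
  define x where "x = c + (r / snd p) *\<^sub>R fst p"
  have "norm (fst p) = \<bar>snd p\<bar>" using null by (metis norm_ge_zero power2_abs abs_ge_zero power2_eq_imp_eq)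
  then have x: "x \<in> sphere c r"
    using nz r by (simp add: x_def dist_norm)
  have px: "(x - c, r) = (r / snd p) *\<^sub>R p"
    using nz by (simp add: x_def prod_eq_iff)
  have "null_line c' r (f x) = span {A (x - c, r)}"
    using A(2)[OF x] image_null_line[OF lin] by simp
  also have "A (x - c, r) = (r / snd p) *\<^sub>R (y - c', r)"
    unfolding px by (simp only: linear_scale[OF lin] p)
  also have "span {\<dots>} = null_line c' r y"
    using nz r by (intro null_line_eqI[OF _ refl]) simp
  finally have "f x = y" using null_line_inject[of r c' "f x" y] r by simp
  with x show ?thesis by (rule that)
qed

section \<open>One step of the construction\<close>

lemma closest_point_line:
  fixes A B X :: "'a :: euclidean_space"
  assumes "A \<noteq> B"
  shows "closest_point (affine hull {A, B}) X = A + (((X - A) \<bullet> (B - A)) / ((B - A) \<bullet> (B - A))) *\<^sub>R (B - A)"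
    (is "_ = ?P")
proof -
  define d t where "d = B - A" and "t = ((X - A) \<bullet> d) / (d \<bullet> d)"
  have hull: "affine hull {A, B} = range (\<lambda>s. A + s *\<^sub>R d)"
    unfolding affine_hull_2_alt d_def by simp
  have dd: "d \<bullet> d \<noteq> 0" using assms by (simp add: d_def)
  have "dist X (A + t *\<^sub>R d) \<le> dist X (A + s *\<^sub>R d)" for s
  proof -
    have orth: "(X - A - t *\<^sub>R d) \<bullet> d = 0"
      using dd by (simp add: t_def inner_diff_left)
    have "X - (A + s *\<^sub>R d) = (X - A - t *\<^sub>R d) + (t - s) *\<^sub>R d"
      by (simp add: algebra_simps)
    moreover have "orthogonal (X - A - t *\<^sub>R d) ((t - s) *\<^sub>R d)"
      using orth by (simp add: orthogonal_def)
    ultimately have "(norm (X - (A + s *\<^sub>R d)))\<^sup>2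
        = (norm (X - A - t *\<^sub>R d))\<^sup>2 + (norm ((t - s) *\<^sub>R d))\<^sup>2"
      by (metis norm_add_Pythagorean)
    then have "(norm (X - A - t *\<^sub>R d))\<^sup>2 \<le> (norm (X - (A + s *\<^sub>R d)))\<^sup>2" by simp
    then show ?thesis by (simp add: dist_norm diff_diff_eq)
  qed
  then have "\<forall>z \<in> affine hull {A, B}. dist X (A + t *\<^sub>R d) \<le> dist X z"
    by (simp add: hull)
  then have "A + t *\<^sub>R d = closest_point (affine hull {A, B}) X"
    by (intro closest_point_unique) (simp_all add: affine_imp_convex closed_affine_hull, auto simp: hull)
  then show ?thesis by (simp add: d_def t_def)
qed

text \<open>The mirror line passes through \<open>V\<^sub>2\<close>, and \<open>U - V\<^sub>2 = W\<^sub>1 - V\<^sub>1\<close> because \<open>V\<^sub>1 W\<^sub>1 U V\<^sub>2\<close> is a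
  parallelogram.  So seen from \<open>V\<^sub>2\<close> the new segment is the old one mirrored in the direction of
  the diagonal \<open>W\<^sub>1 V\<^sub>2\<close>.\<close>

lemma bicycle_step_reflects_segment:
  fixes v1 v2 w :: "real ^ 'n"
  assumes "w \<noteq> v2"
  defines "d \<equiv> v2 - w"
  shows "bicycle_step v1 v2 w - v2 = (2 * ((w - v1) \<bullet> d) / (d \<bullet> d)) *\<^sub>R d - (w - v1)"
proof -
  have dd: "d \<bullet> d \<noteq> 0" using assms by simp
  have split: "v2 - v1 = d + (w - v1)" by (simp add: d_def)
  have "bicycle_step v1 v2 w - v2
      = (2 * ((v2 - v1) \<bullet> d) / (d \<bullet> d)) *\<^sub>R d - d - (v2 - v1)"
    by (simp add: bicycle_step_def reflect_in_line_def closest_point_line[OF assms(1)]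
        d_def[symmetric] Let_def) (simp add: d_def algebra_simps scaleR_2)
  also have "2 * ((v2 - v1) \<bullet> d) / (d \<bullet> d) = 2 + 2 * ((w - v1) \<bullet> d) / (d \<bullet> d)"
    unfolding split inner_add_left using dd by (simp add: field_simps)
  finally show ?thesis
    by (simp add: split scaleR_add_left scaleR_2)
qed

text \<open>The mirror image of a vector has the same length.\<close>

lemma bicycle_step_in_sphere:
  assumes "w \<noteq> v2" "w \<in> sphere v1 l"
  shows "bicycle_step v1 v2 w \<in> sphere v2 l"
proof -
  define d x where "d = v2 - w" and "x = w - v1"
  have dd: "d \<bullet> d \<noteq> 0" using assms by (simp add: d_def)
  define a where "a = 2 * (x \<bullet> d) / (d \<bullet> d)"
  have a: "a * (d \<bullet> d) = 2 * (x \<bullet> d)" using dd by (simp add: a_def)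
  have "(a *\<^sub>R d - x) \<bullet> (a *\<^sub>R d - x) = a * (a * (d \<bullet> d)) - 2 * a * (x \<bullet> d) + x \<bullet> x"
    by (simp add: inner_diff_left inner_diff_right inner_commute algebra_simps)
  also have "\<dots> = x \<bullet> x" unfolding a by simp
  finally have "norm (a *\<^sub>R d - x) = norm x" by (simp add: norm_eq)
  then have "norm (bicycle_step v1 v2 w - v2) = norm (w - v1)"
    using bicycle_step_reflects_segment[OF assms(1), of v1] by (simp add: a_def d_def x_def)
  then show ?thesis using assms(2) by (simp add: dist_norm norm_minus_commute)
qed

text \<open>Up to the factor \<open>l\<^sup>2 - \<bar>v\<bar>\<^sup>2\<close>, the linear map through which a step along the edge \<open>v\<close> acts:
  the numerator and denominator of the mirrored segment, cleared of fractions and made homogeneous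
  by letting the second coordinate \<open>t\<close> stand for \<open>l\<close>.\<close>

definition bicycle_lift :: "real \<Rightarrow> real ^ 'n \<Rightarrow> (real ^ 'n) \<times> real \<Rightarrow> (real ^ 'n) \<times> real" where
  "bicycle_lift l v = (\<lambda>(x, t).
     ((l\<^sup>2 - v \<bullet> v) *\<^sub>R x + (2 * (x \<bullet> v) - 2 * l * t) *\<^sub>R v,
      (l\<^sup>2 + v \<bullet> v) * t - 2 * l * (x \<bullet> v)))"

lemma linear_bicycle_lift: "linear (bicycle_lift l v)"
  by (rule linearI)
    (auto simp: bicycle_lift_def inner_add_left algebra_simps)

lemma lorentz_form_bicycle_lift:
  "lorentz_form (bicycle_lift l v p) (bicycle_lift l v q) = (l\<^sup>2 - v \<bullet> v)\<^sup>2 * lorentz_form p q"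
proof -
  obtain x t y u where pq: "p = (x, t)" "q = (y, u)" by (metis surj_pair)
  have *: "v \<bullet> x = x \<bullet> v" "v \<bullet> y = y \<bullet> v" by (simp_all add: inner_commute)
  define a b c e where "a = x \<bullet> v" and "b = y \<bullet> v" and "c = v \<bullet> v" and "e = x \<bullet> y"
  show ?thesis
    by (simp add: pq bicycle_lift_def lorentz_form_def inner_add_left inner_add_right *
        flip: a_def b_def c_def e_def) algebra
qed

lemma normalized_bicycle_lift_in_lorentz_group:
  assumes "l\<^sup>2 \<noteq> v \<bullet> v"
  shows "(\<lambda>p. inverse (l\<^sup>2 - v \<bullet> v) *\<^sub>R bicycle_lift l v p) \<in> lorentz_group"
proof -
  have *: "lorentz_form (a *\<^sub>R p) (a *\<^sub>R q) = a\<^sup>2 * lorentz_form p q" for a and p q :: "(real ^ 'n) \<times> real"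
    by (simp add: lorentz_form_def algebra_simps power2_eq_square)
  have "lorentz_form (inverse (l\<^sup>2 - v \<bullet> v) *\<^sub>R bicycle_lift l v p)
      (inverse (l\<^sup>2 - v \<bullet> v) *\<^sub>R bicycle_lift l v q) = lorentz_form p q" for p q
    using assms by (simp add: * lorentz_form_bicycle_lift power_inverse)
  then show ?thesis
    by (simp only: lorentz_group_def mem_Collect_eq linear_compose_scale_right[OF linear_bicycle_lift]
        simp_thms)
qed

text \<open>The scalar factor is \<open>\<bar>v - x\<bar>\<^sup>2\<close>, the denominator of the mirror formula.\<close>

lemma bicycle_lift_step:
  assumes "w \<noteq> v2" "w \<in> sphere v1 l"
  shows "bicycle_lift l (v2 - v1) (w - v1, l)
           = ((v2 - w) \<bullet> (v2 - w)) *\<^sub>R (bicycle_step v1 v2 w - v2, l)"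
proof -
  define v x where "v = v2 - v1" and "x = w - v1"
  have d: "v2 - w = v - x" by (simp add: v_def x_def)
  have xx: "x \<bullet> x = l\<^sup>2"
    using assms(2) by (simp add: x_def dist_norm norm_minus_commute flip: power2_norm_eq_inner)
  have vx: "v \<bullet> x = x \<bullet> v" by (simp add: inner_commute)
  have D: "(v - x) \<bullet> (v - x) = v \<bullet> v + l\<^sup>2 - 2 * (x \<bullet> v)"
    by (simp add: inner_diff_left inner_diff_right xx vx)
  have dd: "(v - x) \<bullet> (v - x) \<noteq> 0" using assms(1) by (simp add: v_def x_def)
  have "((v - x) \<bullet> (v - x)) *\<^sub>R (bicycle_step v1 v2 w - v2)
      = (2 * (x \<bullet> (v - x))) *\<^sub>R (v - x) - ((v - x) \<bullet> (v - x)) *\<^sub>R x"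
    using bicycle_step_reflects_segment[OF assms(1), of v1] dd
    by (simp add: d x_def[symmetric] scaleR_diff_right)
  also have "\<dots> = (l\<^sup>2 - v \<bullet> v) *\<^sub>R x + (2 * (x \<bullet> v) - 2 * l * l) *\<^sub>R v"
    unfolding D by (simp add: vec_eq_iff inner_diff_right xx algebra_simps power2_eq_square)
  finally have "((v - x) \<bullet> (v - x)) *\<^sub>R (bicycle_step v1 v2 w - v2)
      = (l\<^sup>2 - v \<bullet> v) *\<^sub>R x + (2 * (x \<bullet> v) - 2 * l * l) *\<^sub>R v" .
  moreover have "((v - x) \<bullet> (v - x)) * l = (l\<^sup>2 + v \<bullet> v) * l - 2 * l * (x \<bullet> v)"
    unfolding D by algebra
  ultimately show ?thesis
    unfolding d v_def[symmetric] x_def[symmetric] bicycle_lift_def by simp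
qed

lemma moebius_between_bicycle_step:
  fixes v1 v2 :: "real ^ 'n"
  assumes "0 < l" "dist v1 v2 \<noteq> l"
  shows "moebius_between v1 v2 l (bicycle_step v1 v2)"
proof -
  define v where "v = v2 - v1"
  have "norm v \<noteq> l" using assms(2) by (simp add: v_def dist_norm norm_minus_commute)
  then have lv: "l\<^sup>2 \<noteq> v \<bullet> v"
    using assms(1) by (metis less_imp_le norm_ge_zero power2_eq_imp_eq power2_norm_eq_inner)
  define A where "A = (\<lambda>p. inverse (l\<^sup>2 - v \<bullet> v) *\<^sub>R bicycle_lift l v p)"
  have A: "A \<in> lorentz_group"
    unfolding A_def by (rule normalized_bicycle_lift_in_lorentz_group[OF lv])
  have ne: "w \<noteq> v2" if "w \<in> sphere v1 l" for w
    using that assms(2) by auto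
  have "null_line v2 l (bicycle_step v1 v2 w) = A ` null_line v1 l w" if w: "w \<in> sphere v1 l" for w
  proof -
    define a where "a = inverse (l\<^sup>2 - v \<bullet> v) * ((v2 - w) \<bullet> (v2 - w))"
    have "a \<noteq> 0" using lv ne[OF w] by (simp add: a_def)
    moreover have "A (w - v1, l) = a *\<^sub>R (bicycle_step v1 v2 w - v2, l)"
      unfolding A_def a_def v_def bicycle_lift_step[OF ne[OF w] w] by simp
    ultimately have "span {A (w - v1, l)} = null_line v2 l (bicycle_step v1 v2 w)"
      by (rule null_line_eqI)
    then show ?thesis
      using A by (simp add: image_null_line lorentz_group_def)
  qed
  then show ?thesis
    unfolding moebius_between_def using A ne bicycle_step_in_sphere by blast
qed

section \<open>The monodromy\<close>

text \<open>The induction supplies the hypothesis on the next edge: the track so far is onto the current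
  sphere, so if that edge had length \<open>l\<close>, some seed would arrive at the next vertex and leave no
  mirror line there.\<close>

lemma moebius_between_bicycle_track:
  assumes l: "0 < l" and cons: "bicycle_constructible k V l" and "i \<le> k"
  shows "moebius_between (V 1) (V (i + 1)) l (\<lambda>w. bicycle_track V w i)"
  using \<open>i \<le> k\<close>
proof (induction i)
  case 0
  then show ?case by (simp add: moebius_between_id)
next
  case (Suc i)
  then have IH: "moebius_between (V 1) (V (i + 1)) l (\<lambda>w. bicycle_track V w i)" by simp
  have "dist (V (i + 1)) (V (i + 2)) \<noteq> l"
  proof
    assume "dist (V (i + 1)) (V (i + 2)) = l"
    then have "V (i + 2) \<in> sphere (V (i + 1)) l" by simp
    then obtain w where "w \<in> sphere (V 1) l" "bicycle_track V w i = V (i + 2)"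
      using moebius_between_onto[OF IH l] by blast
    then show False
      using cons Suc.prems by (auto simp: bicycle_constructible_def)
  qed
  then have "moebius_between (V (i + 1)) (V (i + 2)) l (bicycle_step (V (i + 1)) (V (i + 2)))"
    by (rule moebius_between_bicycle_step[OF l])
  from moebius_between_comp[OF IH this] show ?case by simp
qed

theorem theorem1:
  fixes V :: "nat \<Rightarrow> real ^ 'n" and k :: nat and l :: real
  assumes "closed_polygon k V"
    and "0 < l"
    and "bicycle_constructible k V l"
  shows "moebius_on_sphere (V 1) l (bicycle_monodromy k V l)"
proof -
  have "V (k + 1) = V 1"
    using assms(1) unfolding closed_polygon_def by (metis add.commute)
  then have "moebius_between (V 1) (V 1) l (\<lambda>w. bicycle_track V w k)"
    using moebius_between_bicycle_track[OF assms(2,3), of k] by simp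
  then have "moebius_between (V 1) (V 1) l (bicycle_monodromy k V l)"
    by (rule moebius_between_cong[THEN iffD1, rotated]) (simp add: bicycle_monodromy_def)
  then show ?thesis by (simp add: moebius_between_same_centre)
qed

end
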